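(* The variety $\mathbf{SUB}(\mathcal{LO})$ is locally finite, that is, every finitely generated lattice in $\mathbf{SUB}(\mathcal{LO})$ is finite.
   Context: For a poset $P$, $\mathbf{Co}(P)$ is the lattice of all order-convex subsets of $P$, ordered by inclusion ($X\subseteq P$ is order-convex if $x\leq z\leq y$ and $x,y\in X$ imply $z\in X$). $\mathbf{SUB}(\mathcal{LO})$ is the class of all lattices that can be embedded into a lattice of the form $\prod_{i\in I}\mathbf{Co}(T_i)$ for some family $\langle T_i\mid i\in I\rangle$ of chains (totally ordered sets); it is a variety of lattices. *)

theory Defs
  imports "HOL-Algebra.Lattice" HOL.Hull
begin

definition order_convex :: "'a gorder \<Rightarrow> 'a set \<Rightarrow> bool" where
  "order_convex P X \<longleftrightarrow>
     X \<subseteq> carrier P \<and>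
     (\<forall>x\<in>X. \<forall>y\<in>X. \<forall>z\<in>carrier P. x \<sqsubseteq>\<^bsub>P\<^esub> z \<and> z \<sqsubseteq>\<^bsub>P\<^esub> y \<longrightarrow> z \<in> X)"

definition Co :: "'a gorder \<Rightarrow> 'a set gorder" where
  "Co P = \<lparr>carrier = {X. order_convex P X}, eq = (=), le = (\<subseteq>)\<rparr>"

definition product_gorder :: "'i set \<Rightarrow> ('i \<Rightarrow> 'a gorder) \<Rightarrow> ('i \<Rightarrow> 'a) gorder" where
  "product_gorder I L =
     \<lparr>carrier = (\<Pi>\<^sub>E i\<in>I. carrier (L i)), eq = (=), le = (\<lambda>f g. \<forall>i\<in>I. f i \<sqsubseteq>\<^bsub>L i\<^esub> g i)\<rparr>"

definition lattice_embedding :: "'a gorder \<Rightarrow> 'b gorder \<Rightarrow> ('a \<Rightarrow> 'b) \<Rightarrow> bool" where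
  "lattice_embedding L M f \<longleftrightarrow>
     f \<in> carrier L \<rightarrow> carrier M \<and> inj_on f (carrier L) \<and> join_pres L M f \<and> meet_pres L M f"

text \<open>
  A family of chains is a map \<open>T\<close> into total orders with carriers in the type \<open>'t\<close>; the
  carriers need neither be all of \<open>'t\<close> nor be disjoint. Since HOL cannot quantify over
  types, the index type \<open>'i\<close> and the type \<open>'t\<close> are parameters of the class; a theorem about
  the class with \<open>'a\<close>, \<open>'i\<close> and \<open>'t\<close> all free covers every lattice and every family of chains.
\<close>

definition SUB_LO :: "'i itself \<Rightarrow> 't itself \<Rightarrow> 'a gorder set" where
  "SUB_LO (_ :: 'i itself) (_ :: 't itself) =
     {L. lattice L \<and>
         (\<exists>(I :: 'i set) (T :: 'i \<Rightarrow> 't gorder) f.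
            (\<forall>i\<in>I. total_order (T i)) \<and>
            lattice_embedding L (product_gorder I (\<lambda>i. Co (T i))) f)}"

text \<open>Sublattices may be empty, so the sublattice generated by the empty set is empty.\<close>

definition sublattice :: "'a gorder \<Rightarrow> 'a set \<Rightarrow> bool" where
  "sublattice L S \<longleftrightarrow>
     S \<subseteq> carrier L \<and> (\<forall>x\<in>S. \<forall>y\<in>S. x \<squnion>\<^bsub>L\<^esub> y \<in> S \<and> x \<sqinter>\<^bsub>L\<^esub> y \<in> S)"

definition finitely_generated :: "'a gorder \<Rightarrow> bool" where
  "finitely_generated L \<longleftrightarrow>
     (\<exists>G. finite G \<and> G \<subseteq> carrier L \<and> sublattice L hull G = carrier L)"

definition locally_finite :: "'a gorder set \<Rightarrow> bool" where
  "locally_finite K \<longleftrightarrow> (\<forall>L\<in>K. finitely_generated L \<longrightarrow> finite (carrier L))"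

text \<open>
  The predicates \<^const>\<open>join_pres\<close> and \<^const>\<open>meet_pres\<close> include the requirement that source
  and target are lattices. For \<^const>\<open>SUB_LO\<close> this is no restriction on the target:
\<close>

lemma order_convex_Inter:
  assumes "\<A> \<noteq> {}" and conv: "\<And>X. X \<in> \<A> \<Longrightarrow> order_convex P X"
  shows "order_convex P (\<Inter>\<A>)"
  unfolding order_convex_def
proof (intro conjI ballI impI InterI)
  obtain X where X: "X \<in> \<A>" using assms(1) by blast
  have "\<Inter>\<A> \<subseteq> X"
    using X by (rule Inter_lower)
  also have "X \<subseteq> carrier P"
    using conv[OF X] unfolding order_convex_def by (rule conjunct1)
  finally show "\<Inter>\<A> \<subseteq> carrier P" .
next
  fix x y z X
  assume "x \<in> \<Inter>\<A>" "y \<in> \<Inter>\<A>" "X \<in> \<A>"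
  then have "x \<in> X" "y \<in> X" by simp_all
  moreover assume "z \<in> carrier P" "x \<sqsubseteq>\<^bsub>P\<^esub> z \<and> z \<sqsubseteq>\<^bsub>P\<^esub> y"
  ultimately show "z \<in> X"
    using conv[OF \<open>X \<in> \<A>\<close>] unfolding order_convex_def by blast
qed

lemma lattice_Co: "lattice (Co P)"
proof -
  have po: "partial_order (Co P)"
    by unfold_locales (auto simp: Co_def)
  interpret partial_order "Co P" by (rule po)
  show ?thesis
  proof
    fix X Y assume XY: "X \<in> carrier (Co P)" "Y \<in> carrier (Co P)"
    let ?U = "{Z. order_convex P Z \<and> X \<subseteq> Z \<and> Y \<subseteq> Z}"
    have "order_convex P (carrier P)"
      by (auto simp: order_convex_def)
    with XY have "?U \<noteq> {}"
      unfolding Co_def by (auto simp: order_convex_def)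
    then have "order_convex P (\<Inter>?U)"
      by (rule order_convex_Inter) auto
    then show "\<exists>s. least (Co P) s (Upper (Co P) {X, Y})"
      using XY by (intro exI[of _ "\<Inter>?U"]) (auto simp: least_def Upper_def Co_def)
    have "order_convex P (X \<inter> Y)"
      using XY order_convex_Inter[of "{X, Y}" P] by (auto simp: Co_def)
    then show "\<exists>s. greatest (Co P) s (Lower (Co P) {X, Y})"
      using XY by (intro exI[of _ "X \<inter> Y"]) (auto simp: greatest_def Lower_def Co_def)
  qed
qed

lemma lattice_product:
  assumes "\<And>i. i \<in> I \<Longrightarrow> lattice (L i)"
  shows "lattice (product_gorder I L)"
proof -
  have wpo: "partial_order (L i)" if "i \<in> I" for i
    using assms[OF that] by (simp add: lattice_def upper_semilattice_def)
  have refl: "x \<sqsubseteq>\<^bsub>L i\<^esub> x" if "i \<in> I" "x \<in> carrier (L i)" for i x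
  proof -
    interpret partial_order "L i" using wpo that by blast
    show ?thesis using that by auto
  qed
  have antisym: "x = y"
    if "i \<in> I" "x \<in> carrier (L i)" "y \<in> carrier (L i)" "x \<sqsubseteq>\<^bsub>L i\<^esub> y" "y \<sqsubseteq>\<^bsub>L i\<^esub> x" for i x y
  proof -
    interpret partial_order "L i" using wpo that by blast
    show ?thesis using that le_antisym by auto
  qed
  have trans: "x \<sqsubseteq>\<^bsub>L i\<^esub> z"
    if "i \<in> I" "x \<in> carrier (L i)" "y \<in> carrier (L i)" "z \<in> carrier (L i)"
      "x \<sqsubseteq>\<^bsub>L i\<^esub> y" "y \<sqsubseteq>\<^bsub>L i\<^esub> z" for i x y z
  proof -
    interpret partial_order "L i" using wpo that by blast
    show ?thesis using that le_trans by blast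
  qed
  have carr: "x \<in> carrier (product_gorder I L) \<longleftrightarrow> x \<in> (\<Pi>\<^sub>E i\<in>I. carrier (L i))" for x
    by (simp add: product_gorder_def)
  have le: "x \<sqsubseteq>\<^bsub>product_gorder I L\<^esub> y \<longleftrightarrow> (\<forall>i\<in>I. x i \<sqsubseteq>\<^bsub>L i\<^esub> y i)" for x y
    by (simp add: product_gorder_def)
  have eq: "x .=\<^bsub>product_gorder I L\<^esub> y \<longleftrightarrow> x = y" for x y
    by (simp add: product_gorder_def)
  have mem: "x i \<in> carrier (L i)" if "x \<in> carrier (product_gorder I L)" "i \<in> I" for x i
    using that unfolding carr by (rule PiE_mem)
  have po: "partial_order (product_gorder I L)"
  proof (unfold_locales, unfold eq)
    fix x y assume *: "x \<in> carrier (product_gorder I L)" "y \<in> carrier (product_gorder I L)"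
      "x \<sqsubseteq>\<^bsub>product_gorder I L\<^esub> y" "y \<sqsubseteq>\<^bsub>product_gorder I L\<^esub> x"
    show "x = y"
    proof (rule PiE_ext)
      show "x \<in> (\<Pi>\<^sub>E i\<in>I. carrier (L i))" "y \<in> (\<Pi>\<^sub>E i\<in>I. carrier (L i))"
        using * by (simp_all add: carr)
      show "x i = y i" if "i \<in> I" for i
        using antisym[OF that mem mem] * that by (simp add: le)
    qed
  next
    fix x y z assume *: "x \<sqsubseteq>\<^bsub>product_gorder I L\<^esub> y" "y \<sqsubseteq>\<^bsub>product_gorder I L\<^esub> z"
      "x \<in> carrier (product_gorder I L)" "y \<in> carrier (product_gorder I L)"
      "z \<in> carrier (product_gorder I L)"
    have "x i \<sqsubseteq>\<^bsub>L i\<^esub> z i" if "i \<in> I" for i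
      using trans[OF that mem[OF *(3) that] mem[OF *(4) that] mem[OF *(5) that]] *(1,2) that
      by (simp add: le)
    then show "x \<sqsubseteq>\<^bsub>product_gorder I L\<^esub> z"
      by (simp add: le)
  next
    show "x \<sqsubseteq>\<^bsub>product_gorder I L\<^esub> x" if "x \<in> carrier (product_gorder I L)" for x
      using refl mem[OF that] by (simp add: le)
  qed (auto simp: product_gorder_def)
  interpret P: partial_order "product_gorder I L" by (rule po)
  show ?thesis
  proof
    fix x y assume xy: "x \<in> carrier (product_gorder I L)" "y \<in> carrier (product_gorder I L)"
    have "\<exists>s. least (L i) s (Upper (L i) {x i, y i})" if "i \<in> I" for i
    proof -
      interpret lattice "L i" using that by (rule assms)
      show ?thesis by (rule sup_of_two_exists) (use mem xy that in auto)
    qed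
    then obtain s where s: "least (L i) (s i) (Upper (L i) {x i, y i})" if "i \<in> I" for i
      by metis
    have s_mem: "s i \<in> carrier (L i)"
      and s_le: "x i \<sqsubseteq>\<^bsub>L i\<^esub> s i" "y i \<sqsubseteq>\<^bsub>L i\<^esub> s i"
      and s_min: "u \<in> carrier (L i) \<Longrightarrow> x i \<sqsubseteq>\<^bsub>L i\<^esub> u \<Longrightarrow> y i \<sqsubseteq>\<^bsub>L i\<^esub> u \<Longrightarrow> s i \<sqsubseteq>\<^bsub>L i\<^esub> u"
      if "i \<in> I" for i u
      using s[OF that] mem[OF xy(1) that] mem[OF xy(2) that] by (auto simp: least_def Upper_def)
    have "restrict s I \<in> carrier (product_gorder I L)"
      using s_mem by (simp add: carr)
    then show "\<exists>s. least (product_gorder I L) s (Upper (product_gorder I L) {x, y})"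
      using s_le s_min xy mem
      by (intro exI[of _ "restrict s I"]) (simp add: least_def Upper_def le)
    have "\<exists>s. greatest (L i) s (Lower (L i) {x i, y i})" if "i \<in> I" for i
    proof -
      interpret lattice "L i" using that by (rule assms)
      show ?thesis by (rule inf_of_two_exists) (use mem xy that in auto)
    qed
    then obtain t where t: "greatest (L i) (t i) (Lower (L i) {x i, y i})" if "i \<in> I" for i
      by metis
    have t_mem: "t i \<in> carrier (L i)"
      and t_le: "t i \<sqsubseteq>\<^bsub>L i\<^esub> x i" "t i \<sqsubseteq>\<^bsub>L i\<^esub> y i"
      and t_max: "u \<in> carrier (L i) \<Longrightarrow> u \<sqsubseteq>\<^bsub>L i\<^esub> x i \<Longrightarrow> u \<sqsubseteq>\<^bsub>L i\<^esub> y i \<Longrightarrow> u \<sqsubseteq>\<^bsub>L i\<^esub> t i"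
      if "i \<in> I" for i u
      using t[OF that] mem[OF xy(1) that] mem[OF xy(2) that] by (auto simp: greatest_def Lower_def)
    have "restrict t I \<in> carrier (product_gorder I L)"
      using t_mem by (simp add: carr)
    then show "\<exists>s. greatest (product_gorder I L) s (Lower (product_gorder I L) {x, y})"
      using t_le t_max xy mem
      by (intro exI[of _ "restrict t I"]) (simp add: greatest_def Lower_def le)
  qed
qed

lemma lattice_product_Co: "lattice (product_gorder I (\<lambda>i. Co (T i)))"
  by (intro lattice_product lattice_Co)

end

theory Submission
  imports Defs
begin

text \<open>
  Up to the finitely many lattice-theoretic distinctions that \<open>n\<close> generators can make, a chain
  looks like a finite one. In each chain \<open>T i\<close>, record for every point which generators have an
  element below it and which have an element above it. Points with the same record form
  order-convex blocks, and every convex set generated by the generators is a union of blocks,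
  described by the same records in all chains that realise the same pairs of records
  \<open>(record s, record t)\<close> with \<open>s \<le> t\<close>. There are finitely many records and finitely many sets of
  pairs of records, hence finitely many generated elements.
\<close>

section \<open>Signatures of points and types of chains\<close>

definition signature :: "'t gorder \<Rightarrow> 'g set \<Rightarrow> ('g \<Rightarrow> 't set) \<Rightarrow> 't \<Rightarrow> 'g set \<times> 'g set" where
  "signature P G X t =
     ({g \<in> G. \<exists>x\<in>X g. x \<sqsubseteq>\<^bsub>P\<^esub> t}, {g \<in> G. \<exists>x\<in>X g. t \<sqsubseteq>\<^bsub>P\<^esub> x})"

text \<open>The trace of the order on labels. It forgets the size of the chain, so a finite set of
  labels allows only finitely many types, however many chains the family has.\<close>

definition chain_type :: "'t gorder \<Rightarrow> ('t \<Rightarrow> 's) \<Rightarrow> ('s \<times> 's) set" where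
  "chain_type P \<sigma> = {(\<sigma> s, \<sigma> t) | s t. s \<in> carrier P \<and> t \<in> carrier P \<and> s \<sqsubseteq>\<^bsub>P\<^esub> t}"

text \<open>This is the convex hull of \<open>X \<union> Y\<close>, hence the join in
  \<open>Co P\<close> when \<open>X\<close> and \<open>Y\<close> are convex.\<close>

definition convex_join :: "'t gorder \<Rightarrow> 't set \<Rightarrow> 't set \<Rightarrow> 't set" where
  "convex_join P X Y =
     {z \<in> carrier P. (\<exists>x\<in>X \<union> Y. x \<sqsubseteq>\<^bsub>P\<^esub> z) \<and> (\<exists>y\<in>X \<union> Y. z \<sqsubseteq>\<^bsub>P\<^esub> y)}"

lemma signature_in_Pow: "signature P G X t \<in> Pow G \<times> Pow G"
  by (auto simp: signature_def)

lemma chain_type_subset: "range \<sigma> \<subseteq> S \<Longrightarrow> chain_type P \<sigma> \<subseteq> S \<times> S"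
  by (auto simp: chain_type_def)

text \<open>Going up the chain, the first component of the signature grows and the second shrinks,
  so both are constant between two points at which they agree.\<close>

lemma signature_convex:
  assumes "total_order P" and X: "\<And>g. g \<in> G \<Longrightarrow> X g \<subseteq> carrier P"
    and carr: "s \<in> carrier P" "t \<in> carrier P" "u \<in> carrier P"
    and le: "s \<sqsubseteq>\<^bsub>P\<^esub> t" "t \<sqsubseteq>\<^bsub>P\<^esub> u"
    and eq: "signature P G X s = signature P G X u"
  shows "signature P G X t = signature P G X s"
proof -
  interpret total_order P by fact
  have mono: "fst (signature P G X p) \<subseteq> fst (signature P G X q)"
    "snd (signature P G X q) \<subseteq> snd (signature P G X p)"
    if "p \<sqsubseteq>\<^bsub>P\<^esub> q" "p \<in> carrier P" "q \<in> carrier P" for p q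
    using that X unfolding signature_def by (auto; meson le_trans subsetD)+
  show ?thesis
    using mono[OF le(1) carr(1,2)] mono[OF le(2) carr(2,3)] eq by (auto intro: prod_eqI)
qed

text \<open>A member of \<open>X g\<close> witnesses both conditions itself, by reflexivity.
  Conversely, one element of \<open>X g\<close> below \<open>t\<close> and one above force
  \<open>t\<close> into the convex set.\<close>

lemma mem_iff_signature:
  assumes "total_order P" "order_convex P (X g)" "g \<in> G" "t \<in> carrier P"
  shows "t \<in> X g \<longleftrightarrow> g \<in> fst (signature P G X t) \<and> g \<in> snd (signature P G X t)"
proof -
  interpret total_order P by fact
  show ?thesis
    using assms(2-4) le_refl unfolding signature_def order_convex_def fst_conv snd_conv by blast
qed

lemma order_convex_convex_join:
  assumes "total_order P" "X \<subseteq> carrier P" "Y \<subseteq> carrier P"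
  shows "order_convex P (convex_join P X Y)"
proof -
  interpret total_order P by fact
  have carr: "p \<in> carrier P" if "p \<in> X \<union> Y" for p
    using that assms(2,3) by blast
  show ?thesis
    unfolding order_convex_def
  proof (intro conjI ballI impI)
    fix x y z
    assume "x \<in> convex_join P X Y" "y \<in> convex_join P X Y" and z: "z \<in> carrier P"
      and xzy: "x \<sqsubseteq>\<^bsub>P\<^esub> z \<and> z \<sqsubseteq>\<^bsub>P\<^esub> y"
    then obtain p q where p: "p \<in> X \<union> Y" "p \<sqsubseteq>\<^bsub>P\<^esub> x" and q: "q \<in> X \<union> Y" "y \<sqsubseteq>\<^bsub>P\<^esub> q"
      and xy: "x \<in> carrier P" "y \<in> carrier P"
      unfolding convex_join_def by blast
    have "p \<sqsubseteq>\<^bsub>P\<^esub> z"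
      using le_trans[OF p(2) conjunct1[OF xzy] carr[OF p(1)] xy(1) z] .
    moreover have "z \<sqsubseteq>\<^bsub>P\<^esub> q"
      using le_trans[OF conjunct2[OF xzy] q(2) z xy(2) carr[OF q(1)]] .
    ultimately show "z \<in> convex_join P X Y"
      using p(1) q(1) z unfolding convex_join_def by blast
  qed (auto simp: convex_join_def)
qed

section \<open>Lattice operations on convex sets\<close>

lemma product_Co_meet:
  fixes I :: "'i set" and T :: "'i \<Rightarrow> 't gorder"
  defines "M \<equiv> product_gorder I (\<lambda>i. Co (T i))"
  assumes a: "a \<in> carrier M" and b: "b \<in> carrier M" and i: "i \<in> I"
  shows "(a \<sqinter>\<^bsub>M\<^esub> b) i = a i \<inter> b i"
proof
  interpret lattice M unfolding M_def by (rule lattice_product_Co)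
  \<comment> \<open>Restricting to \<open>I\<close> makes the candidate extensional, as membership
    in the \<open>PiE\<close> carrier requires.\<close>
  let ?c = "\<lambda>i\<in>I. a i \<inter> b i"
  have le: "x \<sqsubseteq>\<^bsub>M\<^esub> y \<longleftrightarrow> (\<forall>i\<in>I. x i \<subseteq> y i)" for x y
    by (simp add: M_def product_gorder_def Co_def)
  have carr: "x \<in> carrier M \<longleftrightarrow> x \<in> (\<Pi>\<^sub>E i\<in>I. {X. order_convex (T i) X})" for x
    by (simp add: M_def product_gorder_def Co_def)
  have "order_convex (T i) (a i \<inter> b i)" if "i \<in> I" for i
    using a b that order_convex_Inter[of "{a i, b i}" "T i"] unfolding carr by (auto simp: PiE_iff)
  then have c: "?c \<in> carrier M"
    unfolding carr by simp
  have "?c \<sqsubseteq>\<^bsub>M\<^esub> a \<sqinter>\<^bsub>M\<^esub> b"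
    using a b c by (intro meet_le) (auto simp: le)
  then show "a i \<inter> b i \<subseteq> (a \<sqinter>\<^bsub>M\<^esub> b) i"
    using i unfolding le by auto
  show "(a \<sqinter>\<^bsub>M\<^esub> b) i \<subseteq> a i \<inter> b i"
    using meet_left[OF a b] meet_right[OF a b] i unfolding le by auto
qed

text \<open>The componentwise hull is an upper bound of \<open>a\<close> and \<open>b\<close> in
  \<open>M\<close>. Each component of the join is convex and contains both sets, so it contains
  their hull.\<close>

lemma product_Co_join:
  fixes I :: "'i set" and T :: "'i \<Rightarrow> 't gorder"
  defines "M \<equiv> product_gorder I (\<lambda>i. Co (T i))"
  assumes T: "\<And>i. i \<in> I \<Longrightarrow> total_order (T i)"
    and a: "a \<in> carrier M" and b: "b \<in> carrier M" and i: "i \<in> I"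
  shows "(a \<squnion>\<^bsub>M\<^esub> b) i = convex_join (T i) (a i) (b i)"
proof
  interpret lattice M unfolding M_def by (rule lattice_product_Co)
  let ?c = "\<lambda>i\<in>I. convex_join (T i) (a i) (b i)"
  have le: "x \<sqsubseteq>\<^bsub>M\<^esub> y \<longleftrightarrow> (\<forall>i\<in>I. x i \<subseteq> y i)" for x y
    by (simp add: M_def product_gorder_def Co_def)
  have carr: "x \<in> carrier M \<longleftrightarrow> x \<in> (\<Pi>\<^sub>E i\<in>I. {X. order_convex (T i) X})" for x
    by (simp add: M_def product_gorder_def Co_def)
  have sub: "a i \<subseteq> carrier (T i)" "b i \<subseteq> carrier (T i)" if "i \<in> I" for i
    using a b that unfolding carr PiE_iff order_convex_def by blast+
  then have c: "?c \<in> carrier M"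
    unfolding carr using T by (simp add: order_convex_convex_join)
  have "a i \<subseteq> ?c i" "b i \<subseteq> ?c i" if "i \<in> I" for i
  proof -
    interpret Ti: total_order "T i" using T that by blast
    show "a i \<subseteq> ?c i" "b i \<subseteq> ?c i"
      using sub[OF that] that Ti.le_refl unfolding convex_join_def by fastforce+
  qed
  then have "a \<squnion>\<^bsub>M\<^esub> b \<sqsubseteq>\<^bsub>M\<^esub> ?c"
    using a b c by (intro join_le) (auto simp: le)
  then show "(a \<squnion>\<^bsub>M\<^esub> b) i \<subseteq> convex_join (T i) (a i) (b i)"
    using i unfolding le by auto
  have "a i \<union> b i \<subseteq> (a \<squnion>\<^bsub>M\<^esub> b) i"
    using join_left[OF a b] join_right[OF a b] i unfolding le by auto
  moreover have "order_convex (T i) ((a \<squnion>\<^bsub>M\<^esub> b) i)"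
    using join_closed[OF a b] i unfolding carr by (auto simp: PiE_iff)
  ultimately show "convex_join (T i) (a i) (b i) \<subseteq> (a \<squnion>\<^bsub>M\<^esub> b) i"
    unfolding order_convex_def convex_join_def by blast
qed

text \<open>The induction step for joins: the elements that enclose \<open>s\<close> in
  \<open>P\<close> are replaced by elements of \<open>Q\<close> with the same labels, and convexity
  of the blocks in \<open>Q\<close> makes these enclose \<open>t\<close>, unless \<open>t\<close>
  itself lies in \<open>X' \<union> Y'\<close>.\<close>

lemma convex_join_transfer:
  assumes Q: "total_order Q"
    and type: "chain_type P \<sigma> = chain_type Q \<rho>"
    and conv: "\<And>p q r. p \<in> carrier Q \<Longrightarrow> q \<in> carrier Q \<Longrightarrow> r \<in> carrier Q \<Longrightarrow>
                  p \<sqsubseteq>\<^bsub>Q\<^esub> q \<Longrightarrow> q \<sqsubseteq>\<^bsub>Q\<^esub> r \<Longrightarrow> \<rho> p = \<rho> r \<Longrightarrow> \<rho> q = \<rho> p"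
    and transfer: "\<And>p q. p \<in> X \<union> Y \<Longrightarrow> q \<in> carrier Q \<Longrightarrow> \<sigma> p = \<rho> q \<Longrightarrow> q \<in> X' \<union> Y'"
    and sub: "X \<subseteq> carrier P" "Y \<subseteq> carrier P"
    and s: "s \<in> convex_join P X Y" and t: "t \<in> carrier Q" and st: "\<sigma> s = \<rho> t"
  shows "t \<in> convex_join Q X' Y'"
proof -
  interpret total_order Q by fact
  obtain x y where xy: "x \<in> X \<union> Y" "y \<in> X \<union> Y" "x \<sqsubseteq>\<^bsub>P\<^esub> s" "s \<sqsubseteq>\<^bsub>P\<^esub> y" and sP: "s \<in> carrier P"
    using s by (auto simp: convex_join_def)
  have carr: "x \<in> carrier P" "y \<in> carrier P"
    using xy sub by auto
  have "(\<sigma> x, \<sigma> s) \<in> chain_type P \<sigma>" "(\<sigma> s, \<sigma> y) \<in> chain_type P \<sigma>"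
    using xy carr sP unfolding chain_type_def by blast+
  \<comment> \<open>Equality of types realises both pairs of labels in \<open>Q\<close>, but the
    partners \<open>t1\<close> and \<open>t2\<close> share only the label of \<open>t\<close>; they
    may differ from \<open>t\<close> and from each other.\<close>
  then obtain x' t1 y' t2 where
    1: "x' \<in> carrier Q" "t1 \<in> carrier Q" "x' \<sqsubseteq>\<^bsub>Q\<^esub> t1" "\<sigma> x = \<rho> x'" "\<sigma> s = \<rho> t1" and
    2: "y' \<in> carrier Q" "t2 \<in> carrier Q" "t2 \<sqsubseteq>\<^bsub>Q\<^esub> y'" "\<sigma> y = \<rho> y'" "\<sigma> s = \<rho> t2"
    unfolding type unfolding chain_type_def by blast
  have mem: "x' \<in> X' \<union> Y'" "y' \<in> X' \<union> Y'"
    using transfer xy 1 2 by auto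
  \<comment> \<open>If \<open>x' \<le> t\<close> fails, then \<open>x'\<close> lies between \<open>t\<close> and \<open>t1\<close>, hence in the block of \<open>t\<close>.\<close>
  have "\<exists>p\<in>X' \<union> Y'. p \<sqsubseteq>\<^bsub>Q\<^esub> t"
  proof (cases "x' \<sqsubseteq>\<^bsub>Q\<^esub> t")
    case False
    then have "t \<sqsubseteq>\<^bsub>Q\<^esub> x'" using total_order_total 1(1) t by blast
    then have "\<rho> x' = \<rho> t" using conv[of t x' t1] 1 t st by simp
    \<comment> \<open>Now \<open>t\<close> carries the label of \<open>x\<close>, so it can serve as
      its own lower witness.\<close>
    then have "t \<in> X' \<union> Y'" using transfer[of x t] xy 1 t by simp
    then show ?thesis using t by auto
  qed (use mem in blast)
  moreover have "\<exists>p\<in>X' \<union> Y'. t \<sqsubseteq>\<^bsub>Q\<^esub> p"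
  proof (cases "t \<sqsubseteq>\<^bsub>Q\<^esub> y'")
    case False
    then have "y' \<sqsubseteq>\<^bsub>Q\<^esub> t" using total_order_total 2(1) t by blast
    then have "\<rho> y' = \<rho> t" using conv[of t2 y' t] 2 t st by simp
    then have "t \<in> X' \<union> Y'" using transfer[of y t] xy 2 t by simp
    then show ?thesis using t by auto
  qed (use mem in blast)
  ultimately show ?thesis
    using t by (simp add: convex_join_def)
qed

section \<open>Invariance and finite coding of the generated elements\<close>

theorem theorem9p5:
  shows "locally_finite (SUB_LO TYPE('i) TYPE('t) :: 'a gorder set)"
  unfolding locally_finite_def
proof (intro ballI impI)
  fix L :: "'a gorder"
  assume "L \<in> SUB_LO TYPE('i) TYPE('t)" and "finitely_generated L"
  then obtain I :: "'i set" and T :: "'i \<Rightarrow> 't gorder" and f and G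
    where "lattice L" and T: "\<And>i. i \<in> I \<Longrightarrow> total_order (T i)"
      and emb: "lattice_embedding L (product_gorder I (\<lambda>i. Co (T i))) f"
      and G: "finite G" "G \<subseteq> carrier L" "sublattice L hull G = carrier L"
    unfolding SUB_LO_def finitely_generated_def by blast
  interpret lattice L by fact
  define M where "M = product_gorder I (\<lambda>i. Co (T i))"
  have fM: "f x \<in> carrier M" if "x \<in> carrier L" for x
    using emb that unfolding lattice_embedding_def M_def by auto
  have inj: "inj_on f (carrier L)"
    using emb unfolding lattice_embedding_def by blast
  have fconv: "order_convex (T i) (f x i)" if "x \<in> carrier L" "i \<in> I" for x i
    using fM[OF that(1)] that(2) by (auto simp: M_def product_gorder_def Co_def PiE_iff)
  then have fsub: "f x i \<subseteq> carrier (T i)" if "x \<in> carrier L" "i \<in> I" for x i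
    using that unfolding order_convex_def by blast
  have fjoin: "f (x \<squnion>\<^bsub>L\<^esub> y) i = convex_join (T i) (f x i) (f y i)"
    if x: "x \<in> carrier L" and y: "y \<in> carrier L" and i: "i \<in> I" for x y i
  proof -
    have "f (x \<squnion>\<^bsub>L\<^esub> y) = f x \<squnion>\<^bsub>M\<^esub> f y"
      using emb x y unfolding lattice_embedding_def join_pres_def M_def by blast
    then show ?thesis
      using product_Co_join[OF T fM[OF x, unfolded M_def] fM[OF y, unfolded M_def] i]
      by (simp add: M_def)
  qed
  have fmeet: "f (x \<sqinter>\<^bsub>L\<^esub> y) i = f x i \<inter> f y i"
    if x: "x \<in> carrier L" and y: "y \<in> carrier L" and i: "i \<in> I" for x y i
  proof -
    have "f (x \<sqinter>\<^bsub>L\<^esub> y) = f x \<sqinter>\<^bsub>M\<^esub> f y"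
      using emb x y unfolding lattice_embedding_def meet_pres_def M_def by blast
    then show ?thesis
      using product_Co_meet[OF fM[OF x, unfolded M_def] fM[OF y, unfolded M_def] i]
      by (simp add: M_def)
  qed

  define \<sigma> where "\<sigma> i = signature (T i) G (\<lambda>g. f g i)" for i
  define \<tau> where "\<tau> i = chain_type (T i) (\<sigma> i)" for i
  define S where "S = Pow G \<times> Pow G"
  have \<sigma>_S: "\<sigma> i t \<in> S" for i t
    unfolding \<sigma>_def S_def by (rule signature_in_Pow)
  then have \<tau>_S: "\<tau> i \<in> Pow (S \<times> S)" for i
    unfolding \<tau>_def by (intro PowI chain_type_subset) auto

  \<comment> \<open>For \<open>i = j\<close> this says that \<open>f x i\<close> is a union of
    blocks. For distinct indices it says that chains of equal type select the same labels.\<close>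
  define invariant where "invariant x \<longleftrightarrow>
      (\<forall>i\<in>I. \<forall>j\<in>I. \<forall>s\<in>f x i. \<forall>t\<in>carrier (T j). \<tau> i = \<tau> j \<longrightarrow> \<sigma> i s = \<sigma> j t \<longrightarrow> t \<in> f x j)" for x
  have invariantD: "t \<in> f x j"
    if "invariant x" "i \<in> I" "j \<in> I" "s \<in> f x i" "t \<in> carrier (T j)" "\<tau> i = \<tau> j" "\<sigma> i s = \<sigma> j t"
    for x i j s t
    using that unfolding invariant_def by blast
  have inv_join: "invariant (x \<squnion>\<^bsub>L\<^esub> y)"
    if x: "x \<in> carrier L" "invariant x" and y: "y \<in> carrier L" "invariant y" for x y
    unfolding invariant_def
  proof (intro ballI impI)
    fix i j s t
    assume ij: "i \<in> I" "j \<in> I" and s: "s \<in> f (x \<squnion>\<^bsub>L\<^esub> y) i" and t: "t \<in> carrier (T j)"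
      and eq: "\<tau> i = \<tau> j" "\<sigma> i s = \<sigma> j t"
    have "t \<in> convex_join (T j) (f x j) (f y j)"
    proof (rule convex_join_transfer)
      show "total_order (T j)" using T ij by blast
      show "chain_type (T i) (\<sigma> i) = chain_type (T j) (\<sigma> j)" using eq by (simp add: \<tau>_def)
      show "\<sigma> j q = \<sigma> j p" if "p \<in> carrier (T j)" "q \<in> carrier (T j)" "r \<in> carrier (T j)"
        "p \<sqsubseteq>\<^bsub>T j\<^esub> q" "q \<sqsubseteq>\<^bsub>T j\<^esub> r" "\<sigma> j p = \<sigma> j r" for p q r
      proof -
        have "f g j \<subseteq> carrier (T j)" if "g \<in> G" for g
          by (rule fsub) (use that G(2) ij(2) in auto)
        then show ?thesis
          unfolding \<sigma>_def
          by (rule signature_convex[OF T[OF ij(2)] _ that(1-5) that(6)[unfolded \<sigma>_def]])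
      qed
      show "q \<in> f x j \<union> f y j" if "p \<in> f x i \<union> f y i" "q \<in> carrier (T j)" "\<sigma> i p = \<sigma> j q" for p q
        using that x(2) y(2) ij eq(1) unfolding invariant_def by blast
    qed (use fsub[OF x(1) ij(1)] fsub[OF y(1) ij(1)] fjoin[OF x(1) y(1) ij(1)] s t eq in auto)
    then show "t \<in> f (x \<squnion>\<^bsub>L\<^esub> y) j"
      using fjoin x y ij by simp
  qed
  have inv_meet: "invariant (x \<sqinter>\<^bsub>L\<^esub> y)"
    if x: "x \<in> carrier L" "invariant x" and y: "y \<in> carrier L" "invariant y" for x y
    unfolding invariant_def
  proof (intro ballI impI)
    fix i j s t
    assume ij: "i \<in> I" "j \<in> I" and s: "s \<in> f (x \<sqinter>\<^bsub>L\<^esub> y) i" and t: "t \<in> carrier (T j)"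
      and eq: "\<tau> i = \<tau> j" "\<sigma> i s = \<sigma> j t"
    have "s \<in> f x i" "s \<in> f y i"
      using s fmeet[OF x(1) y(1) ij(1)] by auto
    then have "t \<in> f x j" "t \<in> f y j"
      using invariantD[OF x(2) ij _ t eq] invariantD[OF y(2) ij _ t eq] by auto
    then show "t \<in> f (x \<sqinter>\<^bsub>L\<^esub> y) j"
      using fmeet[OF x(1) y(1) ij(2)] by auto
  qed
  \<comment> \<open>For a generator, membership can be read off the signature alone.\<close>
  have "invariant g" if "g \<in> G" for g
  proof -
    have g: "g \<in> carrier L"
      using that G(2) by blast
    have mem: "t \<in> f g i \<longleftrightarrow> g \<in> fst (\<sigma> i t) \<and> g \<in> snd (\<sigma> i t)"
      if i: "i \<in> I" and t: "t \<in> carrier (T i)" for i t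
      unfolding \<sigma>_def by (rule mem_iff_signature) (use T fconv g i t \<open>g \<in> G\<close> in auto)
    show ?thesis
      unfolding invariant_def
    proof (intro ballI impI)
      fix i j s t
      assume ij: "i \<in> I" "j \<in> I" and s: "s \<in> f g i" and t: "t \<in> carrier (T j)"
        and "\<sigma> i s = \<sigma> j t"
      then show "t \<in> f g j"
        using mem[OF ij(1) subsetD[OF fsub[OF g ij(1)] s]] mem[OF ij(2) t] by simp
    qed
  qed
  \<comment> \<open>The invariant elements form a sublattice containing \<open>G\<close>, and
    \<open>G\<close> generates \<open>L\<close>.\<close>
  then have "sublattice L hull G \<subseteq> {x \<in> carrier L. invariant x}"
    using G(2) inv_join inv_meet by (intro hull_minimal) (auto simp: sublattice_def)
  then have inv: "invariant x" if "x \<in> carrier L" for x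
    using that G(3) by blast

  \<comment> \<open>The code of \<open>x\<close> records the labels that \<open>x\<close> selects,
    with each index \<open>i\<close> replaced by its type; this keeps the codes within a finite set
    even when \<open>I\<close> is infinite.\<close>
  define \<Phi> where "\<Phi> x = {(\<tau> i, \<sigma> i t) | i t. i \<in> I \<and> t \<in> f x i}" for x
  have \<Phi>_le: "f x i \<subseteq> f y i"
    if "x \<in> carrier L" "y \<in> carrier L" "\<Phi> x = \<Phi> y" "i \<in> I" for x y i
  proof
    fix t assume t: "t \<in> f x i"
    then have "(\<tau> i, \<sigma> i t) \<in> \<Phi> x"
      using that(4) unfolding \<Phi>_def by blast
    then have "(\<tau> i, \<sigma> i t) \<in> \<Phi> y"
      by (simp only: that(3))
    then obtain j s where "j \<in> I" "s \<in> f y j" "\<tau> j = \<tau> i" "\<sigma> j s = \<sigma> i t"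
      unfolding \<Phi>_def by auto
    \<comment> \<open>The point \<open>s\<close> witnessing the code may lie in another chain of the
      same type; invariance of \<open>y\<close> carries it back to \<open>t\<close>.\<close>
    then show "t \<in> f y i"
      by (intro invariantD[OF inv[OF that(2)] _ that(4) _ subsetD[OF fsub[OF that(1,4)] t]])
  qed
  have "inj_on \<Phi> (carrier L)"
  proof (rule inj_onI)
    fix x y assume xy: "x \<in> carrier L" "y \<in> carrier L" "\<Phi> x = \<Phi> y"
    have "f x = f y"
    \<comment> \<open>Values of \<open>f\<close> are extensional, so agreement on \<open>I\<close>
      is equality.\<close>
    proof (rule PiE_ext)
      show "f x \<in> (\<Pi>\<^sub>E i\<in>I. carrier (Co (T i)))" "f y \<in> (\<Pi>\<^sub>E i\<in>I. carrier (Co (T i)))"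
        using fM[OF xy(1)] fM[OF xy(2)] by (simp_all add: M_def product_gorder_def)
      show "f x i = f y i" if "i \<in> I" for i
        using \<Phi>_le[OF xy that] \<Phi>_le[OF xy(2,1) xy(3)[symmetric] that] by (rule subset_antisym)
    qed
    then show "x = y"
      using inj_onD[OF inj _ xy(1,2)] by blast
  qed
  moreover have "\<Phi> ` carrier L \<subseteq> Pow (Pow (S \<times> S) \<times> S)"
    using \<sigma>_S \<tau>_S unfolding \<Phi>_def by blast
  moreover have "finite (Pow (Pow (S \<times> S) \<times> S))"
    using G(1) by (simp add: S_def)
  ultimately show "finite (carrier L)"
    by (rule inj_on_finite)
qed

end
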